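(* Let $t\ge 2$ and $r_1\ge\cdots\ge r_t\ge 2$ be integers, and let $K_{r_1,\dots,r_t}$ be the complete $t$-partite graph with parts of orders $r_1,\dots,r_t$. Then $$\mathrm{gp}_{\mathrm g}(K_{r_1,\dots,r_t}) = \min\{r_1,t\}\qquad\text{and}\qquad \mathrm{gp}_{\mathrm g}'(K_{r_1,\dots,r_t}) = \max\{r_t,t\}.$$
   Context: All graphs are finite, simple and undirected. A set $S\subseteq V(G)$ is in general position if no shortest path of $G$ contains more than two vertices of $S$. In the Builder-Blocker general position game on a graph $G$, two players, Builder and Blocker, alternately choose (mark) an unmarked vertex of $G$ so that at each stage the set of all marked vertices is in general position; the game ends when no further vertex can be selected. Builder aims to make the final set of marked vertices as large as possible, Blocker as small as possible. In the B-game Builder moves first; in the B'-game Blocker moves first. $\mathrm{gp}_{\mathrm g}(G)$ (respectively $\mathrm{gp}_{\mathrm g}'(G)$) is the number of vertices in the final set when the B-game (respectively B'-game) is played optimally by both players. *)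

theory Defs
  imports "Graph_Theory.Vertex_Walk" "HOL-Library.Disjoint_Sets"
begin

text \<open>
  Finite simple undirected graphs are given by the locale predicate \<^const>\<open>graph\<close>:
  finite, loop-free, symmetric digraphs without parallel arcs, so that an edge is a pair of
  opposite arcs. Paths are the vertex lists satisfying \<^const>\<open>vpath\<close>.
\<close>

definition shortest_vpath :: "'a vwalk \<Rightarrow> ('a, 'b) pre_digraph \<Rightarrow> bool" where
  "shortest_vpath p G \<longleftrightarrow> vpath p G \<and>
     (\<forall>q. vpath q G \<and> hd q = hd p \<and> last q = last p \<longrightarrow> vwalk_length p \<le> vwalk_length q)"

definition general_position :: "('a, 'b) pre_digraph \<Rightarrow> 'a set \<Rightarrow> bool" where
  "general_position G S \<longleftrightarrow> S \<subseteq> verts G \<and>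
     (\<forall>p. shortest_vpath p G \<longrightarrow> card (S \<inter> set p) \<le> 2)"

datatype player = Builder | Blocker

fun opponent :: "player \<Rightarrow> player" where
  "opponent Builder = Blocker"
| "opponent Blocker = Builder"

definition legal_moves :: "('a, 'b) pre_digraph \<Rightarrow> 'a set \<Rightarrow> 'a set" where
  "legal_moves G S = {v \<in> verts G - S. general_position G (insert v S)}"

text \<open>
  The argument \<open>S\<close> is the set of vertices marked so far, \<open>P\<close> is the player to move, and the
  result is the size of the final marked set under optimal play of both players from then on.
  The case of infinitely many vertices is irrelevant; it only makes the recursion terminate.
\<close>

function game_value :: "('a, 'b) pre_digraph \<Rightarrow> player \<Rightarrow> 'a set \<Rightarrow> nat" where
  "game_value G P S =
     (if infinite (verts G) \<or> legal_moves G S = {} then card S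
      else (case P of Builder \<Rightarrow> Max | Blocker \<Rightarrow> Min)
             ((\<lambda>v. game_value G (opponent P) (insert v S)) ` legal_moves G S))"
  by pat_completeness auto
termination
proof (relation "Wellfounded.measure (\<lambda>(G, P, S). card (verts G - S))", goal_cases)
  case 1
  show ?case by simp
next
  case (2 G P S v)
  then have "finite (verts G)" "v \<in> verts G - S"
    by (auto simp: legal_moves_def)
  then have "card (verts G - insert v S) < card (verts G - S)"
    by (intro psubset_card_mono) auto
  then show ?case
    by (simp only: in_measure prod.case)
qed

declare game_value.simps [simp del]

definition gp_g :: "('a, 'b) pre_digraph \<Rightarrow> nat" where
  "gp_g G = game_value G Builder {}"

definition gp_g' :: "('a, 'b) pre_digraph \<Rightarrow> nat" where
  "gp_g' G = game_value G Blocker {}"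

text \<open>The parts are indexed by \<open>1, \<dots>, t\<close>, and the \<open>i\<close>-th part has \<open>r i\<close> vertices.\<close>

definition complete_multipartite_graph :: "nat \<Rightarrow> (nat \<Rightarrow> nat) \<Rightarrow> ('a, 'b) pre_digraph \<Rightarrow> bool" where
  "complete_multipartite_graph t r G \<longleftrightarrow> graph G \<and>
     (\<exists>V. disjoint_family_on V {1..t} \<and>
          (\<forall>i\<in>{1..t}. card (V i) = r i) \<and>
          verts G = (\<Union>i\<in>{1..t}. V i) \<and>
          arcs_ends G = (\<Union>i\<in>{1..t}. \<Union>j\<in>{1..t} - {i}. V i \<times> V j))"

text \<open>Such graphs exist for all parameters, so statements about all of them are not vacuous.\<close>

lemma complete_multipartite_graph_exists:
  "\<exists>G :: (nat \<times> nat, (nat \<times> nat) \<times> (nat \<times> nat)) pre_digraph. complete_multipartite_graph t r G"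
proof -
  define V where "V i = {i} \<times> {..<r i}" for i :: nat
  define A where "A = (\<Union>i\<in>{1..t}. \<Union>j\<in>{1..t} - {i}. V i \<times> V j)"
  let ?G = "\<lparr>verts = \<Union>i\<in>{1..t}. V i, arcs = A, tail = fst, head = snd\<rparr>"
  have fin: "finite A"
    unfolding A_def V_def by auto
  have ends: "arcs_ends ?G = A"
    by (simp add: arcs_ends_conv)
  have "symmetric ?G"
    unfolding symmetric_def ends by (auto simp: sym_def A_def)
  then have "graph ?G"
    using fin by unfold_locales (auto simp: A_def V_def arc_to_ends_def)
  moreover have "disjoint_family_on V {1..t}"
    by (auto simp: disjoint_family_on_def V_def)
  moreover have "\<forall>i\<in>{1..t}. card (V i) = r i"
    by (simp add: V_def card_cartesian_product)
  ultimately show ?thesis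
    unfolding complete_multipartite_graph_def
    by (intro exI[of _ ?G] conjI exI[of _ V]) (simp_all only: ends[unfolded A_def] A_def pre_digraph.select_convs)
qed

end

theory Submission
  imports Defs
begin

text \<open>
  In a complete multipartite graph two non-adjacent vertices \<open>u\<close>, \<open>v\<close> lie in the same part and
  every vertex \<open>w\<close> of another part is the middle of a shortest path from \<open>u\<close> to \<open>v\<close>. These are
  the only shortest paths on more than two vertices, so a set is in general position iff
  it stays inside one part or meets every part at most once
  (\<open>general_position_iff\<close>).

  The second move of the game therefore decides it. If it is made in the part of the first
  vertex, all later moves stay in that part until it is exhausted
  (\<open>game_value_same_part\<close>); if it is made in another part, the later moves take one vertex
  from each remaining part (\<open>game_value_distinct_parts\<close>). With the first vertex in the
  \<open>i\<close>-th part, the final set has \<open>r i\<close> vertices in one case and \<open>t\<close> in the other, whatever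
  the players do afterwards. As every part has at least two vertices and there are at least
  two parts, the second player can choose between the two outcomes, while the first player
  chooses the part. So if Builder begins, the result is the largest \<open>min (r i) t\<close>, and if
  Blocker begins, it is the smallest \<open>max (r i) t\<close>.
\<close>

section \<open>Positions whose outcome is forced\<close>

text \<open>
  Every play from \<open>S\<close> ends in a maximal general position set containing \<open>S\<close>; if all of
  these have the same size, neither player can influence the result. This removes the need to
  follow the play after the second move.
\<close>

lemma game_value_eq_if_maximal_sets_card:
  assumes fin: "finite (verts G)"
    and gp: "general_position G S"
    and maximal: "\<And>M. \<lbrakk>S \<subseteq> M; general_position G M; legal_moves G M = {}\<rbrakk> \<Longrightarrow> card M = n"
  shows "game_value G P S = n"
  using gp maximal
proof (induction "card (verts G - S)" arbitrary: S P rule: less_induct)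
  case less
  show ?case
  proof (cases "legal_moves G S = {}")
    case True
    then show ?thesis
      using less.prems by (simp add: game_value.simps)
  next
    case False
    have "game_value G (opponent P) (insert v S) = n" if v: "v \<in> legal_moves G S" for v
    proof (rule less.hyps)
      show "card (verts G - insert v S) < card (verts G - S)"
        using v fin by (intro psubset_card_mono) (auto simp: legal_moves_def)
      show "general_position G (insert v S)"
        using v by (simp add: legal_moves_def)
    qed (use less.prems(2) in auto)
    then have "(\<lambda>v. game_value G (opponent P) (insert v S)) ` legal_moves G S = {n}"
      using False by auto
    then show ?thesis
      using fin False by (simp add: game_value.simps[of G P S] split: player.split)
  qed
qed

section \<open>General position in complete multipartite graphs\<close>

text \<open>
  Describing the parts as the fibres of a colouring \<open>c\<close> turns "inside one part" into
  \<open>c\<close> being constant and "at most one vertex from each part" into \<open>c\<close> being injective.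
  The last two assumptions say that no vertex is alone, neither with its part in the graph nor
  within its part; they give the second player a choice.
\<close>

locale complete_multipartite = fin_digraph G for G :: "('a, 'b) pre_digraph" +
  fixes c :: "'a \<Rightarrow> 'c"
  assumes arcs_ends_iff: "(u, v) \<in> arcs_ends G \<longleftrightarrow> u \<in> verts G \<and> v \<in> verts G \<and> c u \<noteq> c v"
    and other_part: "u \<in> verts G \<Longrightarrow> \<exists>w\<in>verts G. c w \<noteq> c u"
    and same_part: "u \<in> verts G \<Longrightarrow> \<exists>w\<in>verts G. w \<noteq> u \<and> c w = c u"
begin

definition part :: "'a \<Rightarrow> 'a set" where
  "part v = {w \<in> verts G. c w = c v}"

lemma shortest_vpath_same_part:
  assumes "u \<in> verts G" "v \<in> verts G" "w \<in> verts G"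
    and "u \<noteq> v" "c u = c v" "c w \<noteq> c u"
  shows "shortest_vpath [u, w, v] G"
  unfolding shortest_vpath_def
proof (intro conjI allI impI)
  show "vpath [u, w, v] G"
    using assms by (auto simp: vpath_def vwalk_def arcs_ends_iff)
next
  fix q
  assume q: "vpath q G \<and> hd q = hd [u, w, v] \<and> last q = last [u, w, v]"
  have "length q \<ge> 3"
  proof (rule ccontr)
    assume "\<not> length q \<ge> 3"
    with q have "q = [u] \<and> u = v \<or> q = [u, v]"
      by (cases q rule: remdups_adj.cases)
        (auto simp: vpath_def vwalk_def Suc_le_eq split: if_splits)
    with q assms show False
      by (auto simp: vpath_def vwalk_def arcs_ends_iff)
  qed
  then show "vwalk_length [u, w, v] \<le> vwalk_length q"
    by simp
qed

text \<open>
  Adjacent endpoints are joined by an edge, and two vertices of one part by a path through any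
  vertex of another part, so a shortest path has at most three vertices.
\<close>

lemma shortest_vpath_cases:
  assumes "shortest_vpath p G"
  obtains "length p \<le> 2"
  | u w v where "p = [u, w, v]" "u \<noteq> v" "c u = c v" "c w \<noteq> c u"
proof (cases "length p \<le> 2")
  case False
  define u v where "u = hd p" and "v = last p"
  have path: "set p \<subseteq> verts G" "set (vwalk_arcs p) \<subseteq> arcs_ends G" "distinct p"
    using assms by (auto simp: shortest_vpath_def vpath_def vwalk_def)
  have le: "length p \<le> length q" if "vpath q G" "hd q = u" "last q = v" for q
  proof -
    have "length p - 1 \<le> length q - 1"
      using assms that by (simp add: shortest_vpath_def u_def v_def)
    moreover have "q \<noteq> []"
      using that by (auto simp: vpath_def vwalk_def)
    ultimately show ?thesis
      using False by linarith
  qed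
  obtain x y z zs where p: "p = x # y # z # zs"
    using False by (cases p rule: remdups_adj.cases; cases "tl (tl p)") auto
  have uv: "u \<in> verts G" "v \<in> verts G" "u \<noteq> v"
    using path p by (auto simp: u_def v_def)
  have same: "c u = c v"
  proof (rule ccontr)
    assume "c u \<noteq> c v"
    with uv have "vpath [u, v] G"
      by (auto simp: vpath_def vwalk_def arcs_ends_iff)
    from le[OF this] show False
      using False by simp
  qed
  obtain w where "w \<in> verts G" "c w \<noteq> c u"
    using other_part uv(1) by blast
  then have "vpath [u, w, v] G"
    using shortest_vpath_same_part uv same by (simp add: shortest_vpath_def)
  from le[OF this] have "zs = []"
    by (simp add: p)
  then have "p = [u, y, v]"
    by (simp add: p u_def v_def)
  moreover have "c y \<noteq> c u"
    using path(2) \<open>p = [u, y, v]\<close> by (auto simp: arcs_ends_iff)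
  ultimately show ?thesis
    using that uv(3) same by blast
qed

text \<open>
  A set on which \<open>c\<close> is neither constant nor injective contains two vertices of one part and
  one of another part, which form a shortest path. Conversely, a set containing three vertices of
  a shortest path contains exactly such a triple.
\<close>

theorem general_position_iff:
  "general_position G S \<longleftrightarrow>
     S \<subseteq> verts G \<and> ((\<forall>u\<in>S. \<forall>v\<in>S. c u = c v) \<or> inj_on c S)"
proof (intro iffI conjI)
  assume gp: "general_position G S"
  then show sub: "S \<subseteq> verts G"
    by (simp add: general_position_def)
  show "(\<forall>u\<in>S. \<forall>v\<in>S. c u = c v) \<or> inj_on c S"
  proof (rule ccontr)
    assume "\<not> ((\<forall>u\<in>S. \<forall>v\<in>S. c u = c v) \<or> inj_on c S)"
    then obtain u v where uv: "u \<in> S" "v \<in> S" "u \<noteq> v" "c u = c v"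
      and "\<not> (\<forall>u\<in>S. \<forall>v\<in>S. c u = c v)"
      by (auto simp: inj_on_def)
    then obtain w where w: "w \<in> S" "c w \<noteq> c u"
      by metis
    have "shortest_vpath [u, w, v] G"
      using shortest_vpath_same_part uv w sub by blast
    with gp have "card (S \<inter> set [u, w, v]) \<le> 2"
      by (auto simp: general_position_def)
    moreover have "S \<inter> set [u, w, v] = {u, w, v}"
      using uv w by auto
    moreover have "card {u, w, v} = 3"
    proof -
      have "u \<noteq> w" "w \<noteq> v"
        using uv w by metis+
      with uv show ?thesis
        by simp
    qed
    ultimately show False
      by simp
  qed
next
  assume S: "S \<subseteq> verts G \<and> ((\<forall>u\<in>S. \<forall>v\<in>S. c u = c v) \<or> inj_on c S)"
  have "card (S \<inter> set p) \<le> 2" if "shortest_vpath p G" for p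
    using that
  proof (cases rule: shortest_vpath_cases)
    case 1
    have "card (S \<inter> set p) \<le> card (set p)"
      by (intro card_mono) auto
    with 1 show ?thesis
      using card_length[of p] by linarith
  next
    case (2 u w v)
    have "\<not> {u, w, v} \<subseteq> S"
      using S 2 by (auto simp: inj_on_def)
    then have "S \<inter> set p \<subset> {u, w, v}"
      using 2(1) by auto
    then have "card (S \<inter> set p) < card {u, w, v}"
      by (intro psubset_card_mono) auto
    also have "\<dots> \<le> 3"
      by (simp add: card_insert_if)
    finally show ?thesis
      by simp
  qed
  with S show "general_position G S"
    by (simp add: general_position_def)
qed

lemma legal_moves_empty: "legal_moves G {} = verts G"
  by (auto simp: legal_moves_def general_position_iff)

lemma legal_moves_singleton:
  "v \<in> verts G \<Longrightarrow> legal_moves G {v} = verts G - {v}"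
  by (auto simp: legal_moves_def general_position_iff)

section \<open>The second move decides the game\<close>

text \<open>
  A general position set containing two vertices of one part can grow only within this part,
  and there it can always grow.
\<close>

lemma game_value_same_part:
  assumes "u \<in> verts G" "v \<in> verts G" "u \<noteq> v" "c u = c v"
  shows "game_value G P {u, v} = card (part v)"
proof (rule game_value_eq_if_maximal_sets_card)
  fix M
  assume M: "{u, v} \<subseteq> M" "general_position G M" "legal_moves G M = {}"
  have "\<not> inj_on c M"
    using M(1) assms by (auto simp: inj_on_def)
  then have "M \<subseteq> part v"
    using M by (auto simp: general_position_iff part_def)
  moreover have "w \<in> M" if "w \<in> part v" for w
  proof (rule ccontr)
    assume "w \<notin> M"
    moreover have "insert w M \<subseteq> part v"
      using \<open>M \<subseteq> part v\<close> that by simp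
    then have "general_position G (insert w M)"
      by (simp add: general_position_iff part_def subset_iff)
    ultimately have "w \<in> legal_moves G M"
      using that by (simp add: legal_moves_def part_def)
    with M(3) show False
      by simp
  qed
  ultimately have "M = part v"
    by blast
  then show "card M = card (part v)"
    by simp
qed (use assms in \<open>auto simp: general_position_iff\<close>)

text \<open>
  A general position set containing vertices of two parts has at most one vertex in each part,
  and any vertex of a part that it misses can be added.
\<close>

lemma game_value_distinct_parts:
  assumes "u \<in> verts G" "v \<in> verts G" "c u \<noteq> c v"
  shows "game_value G P {u, v} = card (c ` verts G)"
proof (rule game_value_eq_if_maximal_sets_card)
  fix M
  assume M: "{u, v} \<subseteq> M" "general_position G M" "legal_moves G M = {}"
  have inj: "inj_on c M"
    using M(1,2) assms(3) by (auto simp: general_position_iff)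
  have sub: "M \<subseteq> verts G"
    using M(2) by (simp add: general_position_iff)
  have "c w \<in> c ` M" if "w \<in> verts G" for w
  proof (rule ccontr)
    assume "c w \<notin> c ` M"
    then have "w \<notin> M" "general_position G (insert w M)"
      using inj sub that by (auto simp: general_position_iff)
    then have "w \<in> legal_moves G M"
      using that by (simp add: legal_moves_def)
    with M(3) show False
      by simp
  qed
  with sub have "c ` M = c ` verts G"
    by auto
  then show "card M = card (c ` verts G)"
    using card_image[OF inj] by simp
qed (use assms in \<open>auto simp: general_position_iff\<close>)

text \<open>
  The values of the possible second moves are exactly two numbers, attained by a second vertex
  \<open>w\<close> of the same part and by a vertex \<open>x\<close> of another part, so the player to move takes the
  larger or the smaller of them.
\<close>

lemma game_value_one_marked:
  assumes v: "v \<in> verts G"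
  shows "game_value G P {v} =
    (case P of Builder \<Rightarrow> max | Blocker \<Rightarrow> min) (card (part v)) (card (c ` verts G))"
proof -
  let ?value = "\<lambda>u. game_value G (opponent P) {u, v}"
  obtain w where w: "w \<in> verts G" "w \<noteq> v" "c w = c v"
    using same_part v by blast
  obtain x where x: "x \<in> verts G" "c x \<noteq> c v"
    using other_part v by blast
  have "?value ` (verts G - {v}) = {card (part v), card (c ` verts G)}"
  proof (intro equalityI subsetI)
    fix n
    assume "n \<in> ?value ` (verts G - {v})"
    then show "n \<in> {card (part v), card (c ` verts G)}"
      using v game_value_same_part game_value_distinct_parts by blast
  next
    fix n
    assume "n \<in> {card (part v), card (c ` verts G)}"
    then have "n = ?value w \<or> n = ?value x"
      using game_value_same_part[of w v] game_value_distinct_parts[of x v] v w x by auto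
    then show "n \<in> ?value ` (verts G - {v})"
      using w x by blast
  qed
  moreover have "verts G - {v} \<noteq> {}"
    using w by auto
  ultimately show ?thesis
    by (simp add: game_value.simps[of G P "{v}"] legal_moves_singleton v split: player.split)
qed

lemma gp_g_eq_Max:
  assumes "verts G \<noteq> {}"
  shows "gp_g G = Max ((\<lambda>v. min (card (part v)) (card (c ` verts G))) ` verts G)"
  using assms
  by (simp add: gp_g_def game_value.simps[of G _ "{}"] legal_moves_empty game_value_one_marked
      cong: image_cong_simp)

lemma gp_g'_eq_Min:
  assumes "verts G \<noteq> {}"
  shows "gp_g' G = Min ((\<lambda>v. max (card (part v)) (card (c ` verts G))) ` verts G)"
  using assms
  by (simp add: gp_g'_def game_value.simps[of G _ "{}"] legal_moves_empty game_value_one_marked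
      cong: image_cong_simp)

end

section \<open>The two game numbers\<close>

theorem theorem2p7:
  fixes t :: nat and r :: "nat \<Rightarrow> nat" and G :: "('a, 'b) pre_digraph"
  assumes "t \<ge> 2"
    and "\<And>i j. 1 \<le> i \<Longrightarrow> i \<le> j \<Longrightarrow> j \<le> t \<Longrightarrow> r i \<ge> r j"
    and "r t \<ge> 2"
    and "complete_multipartite_graph t r G"
  shows "gp_g G = min (r 1) t \<and> gp_g' G = max (r t) t"
proof -
  obtain V where "graph G" and disj: "disjoint_family_on V {1..t}"
    and card_V: "\<forall>i\<in>{1..t}. card (V i) = r i"
    and verts: "verts G = (\<Union>i\<in>{1..t}. V i)"
    and ends: "arcs_ends G = (\<Union>i\<in>{1..t}. \<Union>j\<in>{1..t} - {i}. V i \<times> V j)"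
    using assms(4) unfolding complete_multipartite_graph_def by (elim conjE exE) (rule that)
  interpret graph G by fact
  have r_ge: "r i \<ge> 2" if "i \<in> {1..t}" for i
    using assms(2)[of i t] assms(3) that by simp
  define c where "c v = (THE i. i \<in> {1..t} \<and> v \<in> V i)" for v
  have c_eq: "c v = i" if "i \<in> {1..t}" "v \<in> V i" for v i
    unfolding c_def
  proof (rule the_equality)
    show "j = i" if "j \<in> {1..t} \<and> v \<in> V j" for j
      using that \<open>i \<in> {1..t}\<close> \<open>v \<in> V i\<close> disj
      unfolding disjoint_family_on_def by blast
  qed (use that in simp)
  have c_part: "c v \<in> {1..t}" "v \<in> V (c v)" if "v \<in> verts G" for v
    using that c_eq unfolding verts by auto
  have other: "\<exists>w\<in>V i. w \<noteq> u" if "i \<in> {1..t}" for u i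
  proof (rule ccontr)
    assume "\<not> (\<exists>w\<in>V i. w \<noteq> u)"
    then have "card (V i) \<le> card {u}"
      by (intro card_mono) auto
    then show False
      using r_ge card_V that by fastforce
  qed
  have image_c: "c ` verts G = {1..t}"
  proof (intro equalityI subsetI)
    fix i
    assume i: "i \<in> {1..t}"
    then obtain w where "w \<in> V i"
      using other[OF i] by blast
    then show "i \<in> c ` verts G"
      using i c_eq verts by blast
  qed (use c_part in auto)
  interpret complete_multipartite G c
  proof
    fix u v
    show "(u, v) \<in> arcs_ends G \<longleftrightarrow> u \<in> verts G \<and> v \<in> verts G \<and> c u \<noteq> c v"
    proof
      assume "(u, v) \<in> arcs_ends G"
      then obtain i j where "i \<in> {1..t}" "j \<in> {1..t}" "i \<noteq> j" "u \<in> V i" "v \<in> V j"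
        unfolding ends by blast
      then show "u \<in> verts G \<and> v \<in> verts G \<and> c u \<noteq> c v"
        using c_eq verts by auto
    next
      assume "u \<in> verts G \<and> v \<in> verts G \<and> c u \<noteq> c v"
      then have "c u \<in> {1..t}" "c v \<in> {1..t} - {c u}" "(u, v) \<in> V (c u) \<times> V (c v)"
        using c_part[of u] c_part[of v] by simp_all
      then show "(u, v) \<in> arcs_ends G"
        unfolding ends by (meson UN_I)
    qed
  next
    fix u
    assume "u \<in> verts G"
    have "1 \<in> c ` verts G" "2 \<in> c ` verts G"
      using assms(1) by (auto simp: image_c)
    then show "\<exists>w\<in>verts G. c w \<noteq> c u"
      by (metis imageE one_eq_numeral_iff semiring_norm(85))
  next
    fix u
    assume u: "u \<in> verts G"
    obtain w where "w \<in> V (c u)" "w \<noteq> u"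
      using other c_part(1)[OF u] by blast
    then show "\<exists>w\<in>verts G. w \<noteq> u \<and> c w = c u"
      using c_part(1)[OF u] c_eq verts by blast
  qed
  have card_part: "card (part v) = r (c v)" if "v \<in> verts G" for v
  proof -
    have "part v = V (c v)"
    proof (intro equalityI subsetI)
      fix w
      assume "w \<in> part v"
      then show "w \<in> V (c v)"
        using c_part(2)[of w] by (simp add: part_def)
    next
      fix w
      assume "w \<in> V (c v)"
      then show "w \<in> part v"
        using c_part(1)[OF that] c_eq[of "c v" w] verts unfolding part_def by blast
    qed
    then show ?thesis
      using card_V c_part(1)[OF that] by simp
  qed
  have images: "(\<lambda>v. f (card (part v))) ` verts G = (\<lambda>i. f (r i)) ` {1..t}" for f :: "nat \<Rightarrow> nat"
    unfolding image_c[symmetric] image_image by (rule image_cong) (simp_all add: card_part)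
  have nonempty: "verts G \<noteq> {}"
    using image_c assms(1) by auto
  have "gp_g G = Max ((\<lambda>i. min (r i) t) ` {1..t})"
    using gp_g_eq_Max[OF nonempty] images[of "\<lambda>n. min n t"] by (simp add: image_c)
  also have "\<dots> = min (r 1) t"
  proof (rule Max_eqI)
    show "y \<le> min (r 1) t" if "y \<in> (\<lambda>i. min (r i) t) ` {1..t}" for y
      using that assms(2)[of 1] by (auto intro: min.coboundedI1)
  qed (use assms(1) in auto)
  finally have "gp_g G = min (r 1) t" .
  moreover have "gp_g' G = Min ((\<lambda>i. max (r i) t) ` {1..t})"
    using gp_g'_eq_Min[OF nonempty] images[of "\<lambda>n. max n t"] by (simp add: image_c)
  moreover have "\<dots> = max (r t) t"
  proof (rule Min_eqI)
    show "max (r t) t \<le> y" if "y \<in> (\<lambda>i. max (r i) t) ` {1..t}" for y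
      using that assms(2)[of _ t] by (auto intro: max.coboundedI1)
  qed (use assms(1) in auto)
  ultimately show ?thesis
    by simp
qed

end
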